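(* Let $A$ be a finite commutative ring with identity, $\sigma$ a ring automorphism of $A$, $n=2k$, and $\mathcal{C}$ a principal $\sigma$-code of length $n$ generated by some monic $g(X)=\sum_{i=0}^{k}g_iX^i\in A[X;\sigma]$ of degree $n-k=k$ with $g_0\in U(A)$. Then the following statements are equivalent: (i) $\mathcal{C}$ is a self-dual $\sigma$-code, i.e. $\mathcal{C}=\mathcal{C}^\perp$. (ii) $\mathcal{C}$ is a principal $\sigma$-constacyclic code with $\mathcal{C}=(g(X))_{n,\sigma}^a$ for some $a\in U(A)$, and $\sigma^k(h_0^{-1})h^*(X)=g(X)$, where $h(X)=\sum_{i=0}^k h_iX^i\in A[X;\sigma]$ satisfies $g(X)h(X)=X^n-\sigma^{-k}(a)$. (iii) For any $l\in\{1,\dots,k\}$, $\sum_{i=0}^l\sigma^{k-l}(g_i)\,g_{i+k-l}=0$.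
   Context: $U(A)$ is the group of units of $A$. $A[X;\sigma]$ is the skew-polynomial ring of elements $\sum a_iX^i$ with multiplication determined by $Xa=\sigma(a)X$; $(p)_l$ is the left ideal generated by $p$. For $h=\sum_{i=0}^k h_iX^i\in A[X;\sigma]$ of degree $k$, $h^*(X)=\sum_{i=0}^k\sigma^i(h_{k-i})X^i$. (In (ii), $g_0h_0=-\sigma^{-k}(a)$ so $h_0$ is a unit.) For $f$ monic of degree $n$ and $g$ a right divisor of $f$, the principal $(f,\sigma)$-code generated by $g$ is the set of $(d_0,\dots,d_{n-1})\in A^n$ with $\sum_{i=0}^{n-1} d_iX^i+(f)_l\in(g)_l/(f)_l$. A principal $\sigma$-code of length $n$ generated by $g$ is a principal $(f,\sigma)$-code generated by $g$ for some monic $f$ of degree $n$ having $g$ as a right divisor; when $f=X^n-a$ with $a\in U(A)$ it is called principal $\sigma$-constacyclic and is denoted $(g(X))_{n,\sigma}^a$ (this notation includes that $g$ is a right divisor of $X^n-a$). The dual is $\mathcal{C}^\perp=\{y\in A^n:\sum_i x_iy_i=0\text{ for all }x\in\mathcal{C}\}$. *)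

theory Defs
  imports
    "HOL-Library.Set_Algebras"
    "Jordan_Normal_Form.Matrix"
    "HOL-Computational_Algebra.Polynomial"
begin

text \<open>
  \<^typ>\<open>'a poly\<close> serves as the set of left-coefficient expressions \<open>\<Sum> a\<^sub>i X\<^sup>i\<close> underlying
  \<open>A[X;\<sigma>]\<close>: coefficients, degree and addition are the same as for ordinary polynomials, but the
  product of \<open>A[X;\<sigma>]\<close> is \<open>skew_mult \<sigma>\<close>, not the multiplication of the type class.  The product is
  the biadditive extension of \<open>(a X\<^sup>i) (b X\<^sup>j) = a \<sigma>\<^sup>i(b) X\<^bsup>i+j\<^esup>\<close>, which is what \<open>X a = \<sigma>(a) X\<close>
  forces.
\<close>

definition skew_mult :: "('a::comm_ring_1 \<Rightarrow> 'a) \<Rightarrow> 'a poly \<Rightarrow> 'a poly \<Rightarrow> 'a poly" where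
  "skew_mult \<sigma> p q =
     (\<Sum>i\<le>degree p. \<Sum>j\<le>degree q. monom (coeff p i * (\<sigma> ^^ i) (coeff q j)) (i + j))"

definition right_divides :: "('a::comm_ring_1 \<Rightarrow> 'a) \<Rightarrow> 'a poly \<Rightarrow> 'a poly \<Rightarrow> bool" where
  "right_divides \<sigma> g f \<longleftrightarrow> (\<exists>q. f = skew_mult \<sigma> q g)"

definition left_ideal :: "('a::comm_ring_1 \<Rightarrow> 'a) \<Rightarrow> 'a poly \<Rightarrow> 'a poly set" where
  "left_ideal \<sigma> p = {skew_mult \<sigma> q p |q. True}"

definition skew_recip :: "('a::comm_ring_1 \<Rightarrow> 'a) \<Rightarrow> 'a poly \<Rightarrow> 'a poly" where
  "skew_recip \<sigma> h = (\<Sum>i\<le>degree h. monom ((\<sigma> ^^ i) (coeff h (degree h - i))) i)"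

text \<open>Only meaningful when \<open>a\<close> is a unit.\<close>

definition unit_inv :: "'a::comm_ring_1 \<Rightarrow> 'a" where
  "unit_inv a = (THE b. a * b = 1)"

definition word_poly :: "'a::comm_ring_1 vec \<Rightarrow> 'a poly" where
  "word_poly d = (\<Sum>i<dim_vec d. monom (d $ i) i)"

text \<open>
  \<open>p +o left_ideal \<sigma> f\<close> is the coset \<open>p + (f)\<^sub>l\<close>, so the image below is \<open>(g)\<^sub>l / (f)\<^sub>l\<close>.
\<close>

definition principal_code ::
    "('a::comm_ring_1 \<Rightarrow> 'a) \<Rightarrow> 'a poly \<Rightarrow> 'a poly \<Rightarrow> 'a vec set" where
  "principal_code \<sigma> f g =
     {d \<in> carrier_vec (degree f).
        word_poly d +o left_ideal \<sigma> f \<in> (\<lambda>p. p +o left_ideal \<sigma> f) ` left_ideal \<sigma> g}"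

definition is_principal_f_code ::
    "('a::comm_ring_1 \<Rightarrow> 'a) \<Rightarrow> nat \<Rightarrow> 'a poly \<Rightarrow> 'a poly \<Rightarrow> 'a vec set \<Rightarrow> bool" where
  "is_principal_f_code \<sigma> n f g C \<longleftrightarrow>
     degree f = n \<and> lead_coeff f = 1 \<and> right_divides \<sigma> g f \<and> C = principal_code \<sigma> f g"

definition is_principal_code ::
    "('a::comm_ring_1 \<Rightarrow> 'a) \<Rightarrow> nat \<Rightarrow> 'a poly \<Rightarrow> 'a vec set \<Rightarrow> bool" where
  "is_principal_code \<sigma> n g C \<longleftrightarrow> (\<exists>f. is_principal_f_code \<sigma> n f g C)"

text \<open>\<open>C = (g(X))\<^sup>a\<^bsub>n,\<sigma>\<^esub>\<close>, including the divisibility requirement on \<open>g\<close>.\<close>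

definition is_constacyclic_code ::
    "('a::comm_ring_1 \<Rightarrow> 'a) \<Rightarrow> nat \<Rightarrow> 'a \<Rightarrow> 'a poly \<Rightarrow> 'a vec set \<Rightarrow> bool" where
  "is_constacyclic_code \<sigma> n a g C \<longleftrightarrow>
     a dvd 1 \<and> is_principal_f_code \<sigma> n (monom 1 n - [:a:]) g C"

definition dual_code :: "nat \<Rightarrow> 'a::comm_ring_1 vec set \<Rightarrow> 'a vec set" where
  "dual_code n C = {y \<in> carrier_vec n. \<forall>x\<in>C. x \<bullet> y = 0}"


text \<open>\<open>skew_mult \<sigma>\<close> is indeed the multiplication of a ring with \<open>X a = \<sigma>(a) X\<close>.\<close>

lemma skew_mult_bound:
  assumes "comm_ring_hom \<sigma>" "degree p \<le> m" "degree q \<le> n"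
  shows "skew_mult \<sigma> p q =
    (\<Sum>i\<le>m. \<Sum>j\<le>n. monom (coeff p i * (\<sigma> ^^ i) (coeff q j)) (i + j))"
proof -
  interpret comm_ring_hom \<sigma> by fact
  have z: "(\<sigma> ^^ i) 0 = 0" for i by (induction i) auto
  have "(\<Sum>j\<le>n. monom (coeff p i * (\<sigma> ^^ i) (coeff q j)) (i + j)) =
      (\<Sum>j\<le>degree q. monom (coeff p i * (\<sigma> ^^ i) (coeff q j)) (i + j))" for i
    by (rule sum.mono_neutral_right) (use assms(3) in \<open>auto simp: z coeff_eq_0\<close>)
  then show ?thesis
    unfolding skew_mult_def
    by (simp, intro sum.mono_neutral_left) (use assms(2) in \<open>auto simp: coeff_eq_0\<close>)
qed

lemma skew_mult_add_left:
  assumes "comm_ring_hom \<sigma>"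
  shows "skew_mult \<sigma> (p + p') q = skew_mult \<sigma> p q + skew_mult \<sigma> p' q"
proof -
  define m where "m = max (degree p) (degree p')"
  have "degree p \<le> m" "degree p' \<le> m" "degree (p + p') \<le> m"
    by (auto simp: m_def degree_add_le_max)
  then show ?thesis
    by (simp add: skew_mult_bound[OF assms, of _ m _ "degree q"] algebra_simps add_monom[symmetric]
        sum.distrib)
qed

lemma skew_mult_add_right:
  assumes "comm_ring_hom \<sigma>"
  shows "skew_mult \<sigma> p (q + q') = skew_mult \<sigma> p q + skew_mult \<sigma> p q'"
proof -
  interpret comm_ring_hom \<sigma> by fact
  have a: "(\<sigma> ^^ i) (x + y) = (\<sigma> ^^ i) x + (\<sigma> ^^ i) y" for i x y
    by (induction i) (auto simp: hom_add)
  define m where "m = max (degree q) (degree q')"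
  have "degree q \<le> m" "degree q' \<le> m" "degree (q + q') \<le> m"
    by (auto simp: m_def degree_add_le_max)
  then show ?thesis
    by (simp add: skew_mult_bound[OF assms, of _ "degree p" _ m] a algebra_simps
        add_monom[symmetric] sum.distrib)
qed

lemma skew_mult_monom:
  assumes "comm_ring_hom \<sigma>"
  shows "skew_mult \<sigma> (monom a i) (monom b j) = monom (a * (\<sigma> ^^ i) b) (i + j)"
proof -
  interpret comm_ring_hom \<sigma> by fact
  have z: "(\<sigma> ^^ i) 0 = 0" for i by (induction i) auto
  have "skew_mult \<sigma> (monom a i) (monom b j) =
     (\<Sum>i'\<le>i. if i' = i then \<Sum>j'\<le>j. if j' = j then monom (a * (\<sigma> ^^ i) b) (i + j) else 0 else 0)"
    unfolding skew_mult_bound[OF assms degree_monom_le degree_monom_le]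
    by (intro sum.cong refl) (auto simp: z if_distrib[of "\<sigma> ^^ i"] if_distrib[of "(*) a"]
        if_distribR simp del: sum.delta sum.delta' intro!: sum.cong)
  also have "\<dots> = monom (a * (\<sigma> ^^ i) b) (i + j)"
    by simp
  finally show ?thesis .
qed

lemma skew_mult_X_const:
  assumes "comm_ring_hom \<sigma>"
  shows "skew_mult \<sigma> (monom 1 1) [:a:] = skew_mult \<sigma> [:\<sigma> a:] (monom 1 1)"
  using skew_mult_monom[OF assms, of 1 1 a 0] skew_mult_monom[OF assms, of "\<sigma> a" 0 1 1]
  by (simp add: monom_0)

lemma poly_monom_induct [case_names monom add]:
  fixes p :: "'a::comm_ring_1 poly"
  assumes "\<And>a i. P (monom a i)" "\<And>p q. P p \<Longrightarrow> P q \<Longrightarrow> P (p + q)"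
  shows "P p"
proof -
  have "P (\<Sum>i\<le>n. monom (coeff p i) i)" for n
    by (induction n) (auto intro: assms)
  from this[of "degree p"] show ?thesis by (simp add: poly_as_sum_of_monoms)
qed

lemma skew_mult_const_left:
  assumes "comm_ring_hom \<sigma>"
  shows "skew_mult \<sigma> [:a:] p = Polynomial.smult a p"
proof (induction p rule: poly_monom_induct)
  case (monom b j)
  show ?case
    using skew_mult_monom[OF assms, of a 0 b j] by (simp add: monom_0 smult_monom)
qed (simp add: skew_mult_add_right[OF assms] smult_add_right)

lemma skew_mult_assoc:
  assumes "comm_ring_hom \<sigma>"
  shows "skew_mult \<sigma> (skew_mult \<sigma> p q) r = skew_mult \<sigma> p (skew_mult \<sigma> q r)"
proof -
  interpret comm_ring_hom \<sigma> by fact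
  have m: "(\<sigma> ^^ i) (x * y) = (\<sigma> ^^ i) x * (\<sigma> ^^ i) y" for i x y
    by (induction i) (auto simp: hom_mult)
  note add = skew_mult_add_left[OF assms] skew_mult_add_right[OF assms]
  show ?thesis
  proof (induction p rule: poly_monom_induct)
    case (monom a i)
    show ?case
    proof (induction q rule: poly_monom_induct)
      case (monom b j)
      show ?case
      proof (induction r rule: poly_monom_induct)
        case (monom c l)
        show ?case
          by (simp add: skew_mult_monom[OF assms] m funpow_add mult.assoc add.assoc)
      qed (simp add: add)
    qed (simp add: add)
  qed (simp add: add)
qed

end

theory Submission
  imports Defs
begin

text \<open>
  Whatever \<open>f\<close> defines it, the code \<open>C\<close> consists of the words of length \<open>2k\<close> whose polynomial
  lies in the left ideal \<open>(g)\<^sub>l\<close>, and since \<open>g\<close> is monic of degree \<open>k\<close> it is spanned by the \<open>k\<close>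
  shifts \<open>X\<^sup>i g\<close>, \<open>i < k\<close>.  Everything is governed by the twisted autocorrelations
  \<open>S\<^sub>d = \<Sum>\<^sub>u \<sigma>\<^sup>d(g\<^sub>u) g\<^bsub>u+d\<^esub>\<close> (\<open>corr d\<close> below), and each of the three
  conditions says that \<open>S\<^sub>d = 0\<close> for all \<open>d < k\<close>; the condition on the coefficients of \<open>g\<close>
  says so literally, with \<open>d = k - l\<close>.

  Self-duality: \<open>X\<^sup>i g\<close> and \<open>X\<^bsup>i+d\<^esup> g\<close> have scalar product \<open>\<sigma>\<^sup>i(S\<^sub>d)\<close>
  (\<open>pairing_shift_shift\<close>), so the vanishing of these sums is the inclusion
  \<open>C \<subseteq> C\<^sup>\<bottom>\<close>.  The reverse inclusion is then automatic
  (\<open>code_self_dual_iff_corr\<close>): right division by \<open>g\<close> subtracts a codeword from a given dual word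
  and leaves a dual word supported on the first \<open>k\<close> positions.  On these positions the shifts form
  a triangular matrix with the units \<open>\<sigma>\<^sup>i(g\<^sub>0)\<close> on the diagonal, so the remainder is zero.

  Factorization: the condition \<open>\<sigma>\<^sup>k(h\<^sub>0\<^bsup>-1\<^esup>) h\<^sup>* = g\<close> says that
  \<open>\<sigma>\<^sup>u(h\<^bsub>k-u\<^esub>) = e g\<^sub>u\<close> for a unit \<open>e\<close>.  For such an \<open>h\<close> the coefficients of \<open>g h\<close> at
  distance \<open>d\<close> from the middle one are, up to a unit and a power of \<open>\<sigma>\<close>, equal to \<open>S\<^sub>d\<close>
  (\<open>coeff_skew_mult_reversal\<close>).  Hence \<open>g h\<close> has only its two extreme coefficients iff the sums
  vanish.

  It remains to see that \<open>g\<close> is also a right divisor of \<open>X\<^bsup>2k\<^esup> - a\<close>, which the factorization,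
  having \<open>g\<close> on the left, does not show directly.  Here self-duality helps: for
  \<open>a = - \<sigma>\<^sup>k(g\<^sub>0) g\<^sub>0\<^bsup>-1\<^esup>\<close> the polynomial \<open>X\<^sup>k g - X\<^bsup>2k\<^esup> + a\<close> has degree below \<open>2k\<close>
  and is orthogonal to every shift, so it lies in \<open>C\<^sup>\<bottom> = C\<close> and thus in \<open>(g)\<^sub>l\<close>
  (\<open>right_divides_of_corr\<close>).
\<close>

section \<open>Skew polynomials, words and left ideals\<close>

lemma comm_ring_hom_funpow:
  fixes \<sigma> :: "'a::comm_ring_1 \<Rightarrow> 'a"
  assumes "comm_ring_hom \<sigma>"
  shows "comm_ring_hom (\<sigma> ^^ i)"
proof -
  interpret comm_ring_hom \<sigma> by fact
  have "(\<sigma> ^^ i) (x + y) = (\<sigma> ^^ i) x + (\<sigma> ^^ i) y" for x y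
    by (induction i) (simp_all add: hom_add)
  moreover have "(\<sigma> ^^ i) (x * y) = (\<sigma> ^^ i) x * (\<sigma> ^^ i) y" for x y
    by (induction i) (simp_all add: hom_mult)
  moreover have "(\<sigma> ^^ i) 0 = 0" by (induction i) simp_all
  moreover have "(\<sigma> ^^ i) 1 = 1" by (induction i) simp_all
  ultimately show ?thesis by unfold_locales
qed

lemma coeff_skew_mult:
  assumes "comm_ring_hom \<sigma>"
  shows "coeff (skew_mult \<sigma> p q) m = (\<Sum>i\<le>m. coeff p i * (\<sigma> ^^ i) (coeff q (m - i)))"
proof -
  interpret pow: comm_ring_hom "\<sigma> ^^ i" for i by (rule comm_ring_hom_funpow[OF assms])
  note add = skew_mult_add_left[OF assms] skew_mult_add_right[OF assms]
  show ?thesis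
  proof (induction p rule: poly_monom_induct)
    case (monom a i)
    show ?case
    proof (induction q rule: poly_monom_induct)
      case (monom b j)
      have "(\<Sum>i'\<le>m. coeff (monom a i) i' * (\<sigma> ^^ i') (coeff (monom b j) (m - i'))) =
          (\<Sum>i'\<le>m. if i' = i then (if i + j = m then a * (\<sigma> ^^ i) b else 0) else 0)"
        by (rule sum.cong) auto
      then show ?case by (auto simp: skew_mult_monom[OF assms])
    qed (simp add: add pow.hom_add algebra_simps sum.distrib)
  qed (simp add: add algebra_simps sum.distrib)
qed

lemma coeff_sum_monom:
  "coeff (\<Sum>i\<le>n. monom (c i) i) m = (if m \<le> n then c m else 0)"
  by (simp add: coeff_sum)

lemma coeff_word_poly:
  "coeff (word_poly d) m = (if m < dim_vec d then d $ m else 0)"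
  by (simp add: word_poly_def coeff_sum)

lemma word_poly_vec_coeff:
  assumes "\<And>m. n \<le> m \<Longrightarrow> coeff p m = 0"
  shows "word_poly (vec n (coeff p)) = p"
  by (rule poly_eqI) (auto simp: coeff_word_poly assms)

lemma unit_inv_eq:
  assumes "a * b = (1 :: 'a :: comm_ring_1)"
  shows "unit_inv a = b"
  unfolding unit_inv_def
proof (rule the_equality)
  fix c assume "a * c = 1"
  then show "c = b" using assms by (metis mult.assoc mult.commute mult.right_neutral)
qed fact

lemma left_ideal_add:
  assumes "comm_ring_hom \<sigma>" "p \<in> left_ideal \<sigma> g" "q \<in> left_ideal \<sigma> g"
  shows "p + q \<in> left_ideal \<sigma> g"
  using assms(2,3) unfolding left_ideal_def by (auto simp: skew_mult_add_left[OF assms(1), symmetric])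

lemma left_ideal_skew_mult:
  assumes "comm_ring_hom \<sigma>" "p \<in> left_ideal \<sigma> g"
  shows "skew_mult \<sigma> r p \<in> left_ideal \<sigma> g"
  using assms(2) unfolding left_ideal_def by (auto simp: skew_mult_assoc[OF assms(1), symmetric])

lemma left_ideal_uminus:
  assumes "comm_ring_hom \<sigma>" "p \<in> left_ideal \<sigma> g"
  shows "- p \<in> left_ideal \<sigma> g"
  using left_ideal_skew_mult[OF assms, of "[:-1:]"] by (simp add: skew_mult_const_left[OF assms(1)])

lemma zero_in_left_ideal: "0 \<in> left_ideal \<sigma> g"
  unfolding left_ideal_def by (auto simp: skew_mult_def intro!: exI[of _ 0])

text \<open>
  Since \<open>g\<close> divides \<open>f\<close> on the right, \<open>(f)\<^sub>l \<subseteq> (g)\<^sub>l\<close>, so membership of a coset in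
  \<open>(g)\<^sub>l / (f)\<^sub>l\<close> can be tested on any representative.  In particular the code depends on \<open>f\<close> only
  through its degree.
\<close>

lemma principal_code_eq:
  assumes \<sigma>: "comm_ring_hom \<sigma>" and "is_principal_f_code \<sigma> n f g C"
  shows "C = {d \<in> carrier_vec n. word_poly d \<in> left_ideal \<sigma> g}"
proof -
  have n: "degree f = n" and C: "C = principal_code \<sigma> f g" and "right_divides \<sigma> g f"
    using assms(2) by (auto simp: is_principal_f_code_def)
  then have f: "f \<in> left_ideal \<sigma> g"
    by (auto simp: right_divides_def left_ideal_def)
  have "p +o left_ideal \<sigma> f \<in> (\<lambda>p. p +o left_ideal \<sigma> f) ` left_ideal \<sigma> g
      \<longleftrightarrow> p \<in> left_ideal \<sigma> g" for p
  proof
    assume "p +o left_ideal \<sigma> f \<in> (\<lambda>p. p +o left_ideal \<sigma> f) ` left_ideal \<sigma> g"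
    then obtain q where q: "q \<in> left_ideal \<sigma> g" and eq: "p +o left_ideal \<sigma> f = q +o left_ideal \<sigma> f"
      by auto
    have "p \<in> p +o left_ideal \<sigma> f"
      using zero_in_left_ideal[of \<sigma> f] by (force simp: elt_set_plus_def)
    then obtain r where r: "r \<in> left_ideal \<sigma> f" and "p = q + r"
      unfolding eq by (auto simp: elt_set_plus_def)
    moreover have "r \<in> left_ideal \<sigma> g"
      using r left_ideal_skew_mult[OF \<sigma> f] by (auto simp: left_ideal_def[of \<sigma> f])
    ultimately show "p \<in> left_ideal \<sigma> g" using q left_ideal_add[OF \<sigma>] by simp
  qed auto
  then show ?thesis by (simp add: C principal_code_def n)
qed

section \<open>The span of the shifts of the generator\<close>

locale skew_generator = comm_ring_hom \<sigma>
  for \<sigma> :: "'a :: comm_ring_1 \<Rightarrow> 'a" +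
  fixes k :: nat and g :: "'a poly"
  assumes k_pos: "0 < k"
    and degree_g: "degree g = k"
    and monic_g: "coeff g k = 1"
    and unit_g0: "coeff g 0 dvd 1"
begin

lemma hom: "comm_ring_hom \<sigma>" ..

sublocale pow: comm_ring_hom "\<sigma> ^^ i" for i
  by (rule comm_ring_hom_funpow[OF hom])

lemma coeff_g_eq_0: "k < i \<Longrightarrow> coeff g i = 0"
  using degree_g by (simp add: coeff_eq_0)

definition code :: "'a vec set" where
  "code = {d \<in> carrier_vec (2 * k). word_poly d \<in> left_ideal \<sigma> g}"

text \<open>
  The scalar product of words, extended to all polynomials by ignoring the terms from \<open>X\<^bsup>2k\<^esup>\<close> on;
  this makes it applicable to \<open>X\<^sup>k g\<close>, which is one position too long to be a word.
\<close>

definition pairing :: "'a poly \<Rightarrow> 'a poly \<Rightarrow> 'a" where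
  "pairing p q = (\<Sum>m<2 * k. coeff p m * coeff q m)"

definition shift :: "nat \<Rightarrow> 'a poly" where
  "shift i = skew_mult \<sigma> (monom 1 i) g"

definition corr :: "nat \<Rightarrow> 'a" where
  "corr d = (\<Sum>u=0..k - d. (\<sigma> ^^ d) (coeff g u) * coeff g (u + d))"

lemma pairing_commute: "pairing p q = pairing q p"
  by (simp add: pairing_def mult.commute)

lemma pairing_add_right: "pairing p (q + r) = pairing p q + pairing p r"
  by (simp add: pairing_def algebra_simps sum.distrib)

lemma scalar_prod_eq_pairing:
  assumes "x \<in> carrier_vec (2 * k)" "y \<in> carrier_vec (2 * k)"
  shows "x \<bullet> y = pairing (word_poly x) (word_poly y)"
  using assms by (auto simp: scalar_prod_def pairing_def coeff_word_poly atLeast0LessThan)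

lemma coeff_shift: "coeff (shift i) m = (if i \<le> m then (\<sigma> ^^ i) (coeff g (m - i)) else 0)"
proof -
  have "coeff (shift i) m = (\<Sum>j\<le>m. if j = i then (\<sigma> ^^ i) (coeff g (m - i)) else 0)"
    unfolding shift_def coeff_skew_mult[OF hom] by (rule sum.cong) auto
  then show ?thesis by simp
qed

lemma coeff_shift_eq_0: "i + k < m \<Longrightarrow> coeff (shift i) m = 0"
  by (simp add: coeff_shift coeff_g_eq_0)

lemma shift_in_left_ideal: "shift i \<in> left_ideal \<sigma> g"
  by (auto simp: shift_def left_ideal_def)

text \<open>
  The two shifts overlap in the positions \<open>i + d, \<dots>, i + k\<close>, and \<open>i < k\<close> keeps these inside the word, so
  the truncation loses nothing.  The case \<open>i + d = k\<close>, beyond the spanning shifts, is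
  the one that yields the constacyclic modulus.
\<close>

lemma pairing_shift_shift:
  assumes "i < k" "d \<le> k"
  shows "pairing (shift i) (shift (i + d)) = (\<sigma> ^^ i) (corr d)"
proof -
  have "pairing (shift i) (shift (i + d)) = (\<Sum>m\<in>{i + d..i + k}. coeff (shift i) m * coeff (shift (i + d)) m)"
    unfolding pairing_def
    by (rule sum.mono_neutral_right) (use assms in \<open>auto simp: not_le coeff_shift_eq_0, auto simp: coeff_shift\<close>)
  also have "\<dots> = (\<Sum>u=0..k - d. coeff (shift i) (u + (i + d)) * coeff (shift (i + d)) (u + (i + d)))"
    using assms sum.shift_bounds_cl_nat_ivl[of "\<lambda>m. coeff (shift i) m * coeff (shift (i + d)) m" 0 "i + d" "k - d"]
    by (simp add: add.commute)
  also have "\<dots> = (\<sigma> ^^ i) (corr d)"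
    unfolding corr_def pow.hom_sum
  proof (rule sum.cong)
    fix u
    have "u + (i + d) - i = u + d" by simp
    then show "coeff (shift i) (u + (i + d)) * coeff (shift (i + d)) (u + (i + d)) =
        (\<sigma> ^^ i) ((\<sigma> ^^ d) (coeff g u) * coeff g (u + d))"
      by (simp add: coeff_shift pow.hom_mult funpow_add mult.commute)
  qed simp
  finally show ?thesis .
qed

lemma coeff_skew_mult_shifts:
  assumes "\<And>i. K \<le> i \<Longrightarrow> coeff q i = 0"
  shows "coeff (skew_mult \<sigma> q g) m = (\<Sum>i<K. coeff q i * coeff (shift i) m)"
proof -
  let ?t = "\<lambda>i. coeff q i * coeff (shift i) m"
  have "coeff (skew_mult \<sigma> q g) m = (\<Sum>i\<le>m. ?t i)"
    unfolding coeff_skew_mult[OF hom] by (rule sum.cong) (auto simp: coeff_shift)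
  also have "\<dots> = (\<Sum>i\<in>{..m} \<union> {..<K}. ?t i)"
    by (rule sum.mono_neutral_left) (auto simp: coeff_shift)
  also have "\<dots> = (\<Sum>i<K. ?t i)"
    by (rule sum.mono_neutral_right) (auto simp: assms)
  finally show ?thesis .
qed

text \<open>
  Although \<open>A\<close> may have zero divisors, degrees add up when the right factor is monic, because
  powers of \<open>\<sigma>\<close> fix its leading coefficient.
\<close>

lemma degree_quotient_less:
  assumes "\<And>m. 2 * k \<le> m \<Longrightarrow> coeff (skew_mult \<sigma> q g) m = 0"
  shows "degree q < k"
proof (rule ccontr)
  assume "\<not> degree q < k"
  then have q: "k \<le> degree q" by simp
  have "coeff (skew_mult \<sigma> q g) (degree q + k) =
      (\<Sum>i<Suc (degree q). coeff q i * coeff (shift i) (degree q + k))"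
    by (rule coeff_skew_mult_shifts) (simp add: coeff_eq_0)
  also have "\<dots> = (\<Sum>i\<in>{degree q}. coeff q i * coeff (shift i) (degree q + k))"
    by (rule sum.mono_neutral_right) (auto simp: coeff_shift_eq_0)
  also have "\<dots> = lead_coeff q"
    by (simp add: coeff_shift monic_g)
  finally have "q = 0" using assms[of "degree q + k"] q by simp
  then show False using q k_pos by simp
qed

lemma pairing_code_shift:
  assumes "\<And>m. 2 * k \<le> m \<Longrightarrow> coeff p m = 0" "p \<in> left_ideal \<sigma> g"
    and "\<And>i. i < k \<Longrightarrow> pairing (shift i) r = 0"
  shows "pairing p r = 0"
proof -
  obtain q where p: "p = skew_mult \<sigma> q g" using assms(2) by (auto simp: left_ideal_def)
  have "degree q < k" using assms(1) unfolding p by (rule degree_quotient_less)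
  then have "coeff p m = (\<Sum>i<k. coeff q i * coeff (shift i) m)" for m
    unfolding p by (intro coeff_skew_mult_shifts) (simp add: coeff_eq_0)
  then have "pairing p r = (\<Sum>i<k. coeff q i * pairing (shift i) r)"
    unfolding pairing_def by (simp only: sum_distrib_left sum_distrib_right mult.assoc sum.swap[of _ "{..<k}"])
  then show ?thesis using assms(3) by simp
qed

section \<open>Self-duality\<close>

lemma in_dual_code_iff:
  "y \<in> dual_code (2 * k) code \<longleftrightarrow>
     y \<in> carrier_vec (2 * k) \<and> (\<forall>i<k. pairing (shift i) (word_poly y) = 0)"
proof (intro iffI conjI allI impI)
  assume y: "y \<in> dual_code (2 * k) code"
  then show car: "y \<in> carrier_vec (2 * k)" by (simp add: dual_code_def)
  fix i assume i: "i < k"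
  let ?x = "vec (2 * k) (coeff (shift i))"
  have x: "word_poly ?x = shift i"
    by (rule word_poly_vec_coeff) (use i in \<open>simp add: coeff_shift_eq_0\<close>)
  then have "?x \<in> code" by (simp add: code_def shift_in_left_ideal)
  then have "?x \<bullet> y = 0" using y by (simp add: dual_code_def)
  then show "pairing (shift i) (word_poly y) = 0"
    using scalar_prod_eq_pairing[OF _ car, of ?x] x by simp
next
  assume y: "y \<in> carrier_vec (2 * k) \<and> (\<forall>i<k. pairing (shift i) (word_poly y) = 0)"
  have "x \<bullet> y = 0" if "x \<in> code" for x
  proof -
    have x: "x \<in> carrier_vec (2 * k)" "word_poly x \<in> left_ideal \<sigma> g"
      using that by (auto simp: code_def)
    have "pairing (word_poly x) (word_poly y) = 0"
      by (rule pairing_code_shift) (use x y in \<open>auto simp: coeff_word_poly\<close>)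
    then show ?thesis using scalar_prod_eq_pairing x y by simp
  qed
  then show "y \<in> dual_code (2 * k) code" using y by (simp add: dual_code_def)
qed

text \<open>
  Right division by the monic \<open>g\<close>: the top coefficient is removed by a multiple of \<open>X\<^sup>N g\<close>.
\<close>

lemma skew_division:
  assumes "\<And>m. N + k \<le> m \<Longrightarrow> coeff p m = 0"
  shows "\<exists>q r. q \<in> left_ideal \<sigma> g \<and> p = q + r \<and> (\<forall>m\<ge>k. coeff r m = 0)"
  using assms
proof (induction N arbitrary: p)
  case 0
  then have "p = 0 + p \<and> (\<forall>m\<ge>k. coeff p m = 0)" by simp
  then show ?case using zero_in_left_ideal by blast
next
  case (Suc N)
  define t where "t = skew_mult \<sigma> [:coeff p (N + k):] (shift N)"
  have t: "t \<in> left_ideal \<sigma> g"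
    unfolding t_def by (rule left_ideal_skew_mult[OF hom shift_in_left_ideal])
  have "coeff (p - t) m = 0" if "N + k \<le> m" for m
  proof (cases "m = N + k")
    case True
    then show ?thesis by (simp add: t_def skew_mult_const_left[OF hom] coeff_shift monic_g)
  next
    case False
    then show ?thesis using that Suc.prems[of m]
      by (simp add: t_def skew_mult_const_left[OF hom] coeff_shift_eq_0)
  qed
  from Suc.IH[OF this] obtain q r where
    qr: "q \<in> left_ideal \<sigma> g" "p - t = q + r" "\<forall>m\<ge>k. coeff r m = 0" by auto
  then have "p = (q + t) + r" by (simp add: algebra_simps)
  then show ?case using left_ideal_add[OF hom qr(1) t] qr(3) by blast
qed

text \<open>
  \<open>X\<^sup>i g\<close> starts at position \<open>i\<close> with the unit \<open>\<sigma>\<^sup>i(g\<^sub>0)\<close>, so back substitution from position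
  \<open>k - 1\<close> downwards kills the coefficients of \<open>r\<close> one after the other.
\<close>

lemma short_orthogonal_eq_0:
  assumes "\<And>m. k \<le> m \<Longrightarrow> coeff r m = 0" and "\<And>i. i < k \<Longrightarrow> pairing (shift i) r = 0"
  shows "r = 0"
proof -
  have "coeff r (k - d) = 0" for d
  proof (induction d rule: less_induct)
    case (less d)
    show ?case
    proof (cases "d = 0 \<or> k < d")
      case True
      then show ?thesis using assms(1)[of k] less[of k] by auto
    next
      case False
      define i where "i = k - d"
      have i: "i < k" using False k_pos by (simp add: i_def)
      have hi: "coeff r m = 0" if "i < m" for m
      proof (cases "m < k")
        case True
        then show ?thesis using less[of "k - m"] that False by (simp add: i_def)
      qed (simp add: assms(1))
      obtain e where e: "coeff g 0 * e = 1" using unit_g0 by (auto simp: dvd_def)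
      have "pairing (shift i) r = (\<Sum>m\<in>{i}. coeff (shift i) m * coeff r m)"
        unfolding pairing_def
        by (rule sum.mono_neutral_right) (use i hi in \<open>auto simp: coeff_shift\<close>)
      then have "(\<sigma> ^^ i) (coeff g 0) * coeff r i = 0" using assms(2)[OF i] by (simp add: coeff_shift)
      moreover have "(\<sigma> ^^ i) (coeff g 0 * e) * coeff r i =
          (\<sigma> ^^ i) e * ((\<sigma> ^^ i) (coeff g 0) * coeff r i)"
        unfolding pow.hom_mult by (simp only: mult_ac)
      ultimately have "(\<sigma> ^^ i) (coeff g 0 * e) * coeff r i = 0"
        by simp
      then show ?thesis by (simp add: e i_def)
    qed
  qed
  from this[of "k - m" for m] show ?thesis
    using assms(1) by (intro poly_eqI) (metis coeff_0 diff_diff_cancel nat_le_linear)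
qed

text \<open>
  Only \<open>C\<^sup>\<bottom> \<subseteq> C\<close> needs more than the products of shifts.  It follows by division:
  the remainder of a dual word modulo \<open>g\<close> is again orthogonal to \<open>C\<close>, since the
  subtracted codeword is, and has no room to be nonzero.
\<close>

lemma code_self_dual_iff_corr:
  "code = dual_code (2 * k) code \<longleftrightarrow> (\<forall>d<k. corr d = 0)"
proof
  assume sd: "code = dual_code (2 * k) code"
  show "\<forall>d<k. corr d = 0"
  proof (intro allI impI)
    fix d assume d: "d < k"
    let ?y = "vec (2 * k) (coeff (shift d))"
    have y: "word_poly ?y = shift d"
      by (rule word_poly_vec_coeff) (use d in \<open>simp add: coeff_shift_eq_0\<close>)
    then have "?y \<in> dual_code (2 * k) code"
      using sd by (auto simp: code_def shift_in_left_ideal)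
    then have "pairing (shift 0) (shift d) = 0"
      using y k_pos by (simp add: in_dual_code_iff)
    then show "corr d = 0" using pairing_shift_shift[of 0 d] d k_pos by simp
  qed
next
  assume corr: "\<forall>d<k. corr d = 0"
  have le: "pairing (shift i) (shift j) = 0" if "i \<le> j" "j < k" for i j
    using pairing_shift_shift[of i "j - i"] corr that by simp
  have shifts: "pairing (shift i) (shift j) = 0" if "i < k" "j < k" for i j
    using le[of i j] le[of j i] that pairing_commute by (metis nat_le_linear)
  have orth: "pairing (shift i) p = 0"
    if "i < k" "\<And>m. 2 * k \<le> m \<Longrightarrow> coeff p m = 0" "p \<in> left_ideal \<sigma> g" for i p
    using pairing_code_shift[of p "shift i"] that shifts by (metis pairing_commute)
  show "code = dual_code (2 * k) code"
  proof (intro equalityI subsetI)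
    fix y assume "y \<in> code"
    then have "y \<in> carrier_vec (2 * k)" "word_poly y \<in> left_ideal \<sigma> g"
      by (auto simp: code_def)
    then show "y \<in> dual_code (2 * k) code"
      unfolding in_dual_code_iff by (auto simp: coeff_word_poly intro!: orth)
  next
    fix y assume "y \<in> dual_code (2 * k) code"
    then have car: "y \<in> carrier_vec (2 * k)"
      and y: "\<And>i. i < k \<Longrightarrow> pairing (shift i) (word_poly y) = 0" by (auto simp: in_dual_code_iff)
    have "\<And>m. k + k \<le> m \<Longrightarrow> coeff (word_poly y) m = 0"
      using car by (auto simp: coeff_word_poly)
    then obtain q r where q: "q \<in> left_ideal \<sigma> g" and qr: "word_poly y = q + r"
      and r: "\<forall>m\<ge>k. coeff r m = 0"
      using skew_division by blast
    have qc: "coeff q m = 0" if "2 * k \<le> m" for m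
    proof -
      have "coeff q m + coeff r m = coeff (word_poly y) m" by (simp add: qr)
      then show ?thesis using r that car by (simp add: coeff_word_poly)
    qed
    have "r = 0"
    proof (rule short_orthogonal_eq_0)
      fix i assume i: "i < k"
      show "pairing (shift i) r = 0"
        using y[OF i] orth[OF i qc q] by (simp add: qr pairing_add_right)
    qed (use r in auto)
    then show "y \<in> code" using q qr car by (simp add: code_def)
  qed
qed

section \<open>Factorizations of the constacyclic modulus\<close>

text \<open>
  Substituting the reversal relation turns the convolution defining a coefficient of \<open>g h\<close> into a
  correlation of \<open>g\<close> with itself.  Below the middle, the twist has to be completed by \<open>\<sigma>\<^sup>d\<close> for the
  relation to apply with exponent \<open>k - j = u + d\<close>; above it, a factor \<open>\<sigma>\<^sup>d\<close> splits off instead.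
\<close>

lemma coeff_skew_mult_reversal:
  assumes rev: "\<And>u. u \<le> k \<Longrightarrow> (\<sigma> ^^ u) (coeff h (k - u)) = e * coeff g u"
    and deg: "degree h \<le> k" and d: "d \<le> k"
  shows "(\<sigma> ^^ d) (coeff (skew_mult \<sigma> g h) (k - d)) = e * corr d" (is ?low)
    and "coeff (skew_mult \<sigma> g h) (k + d) = (\<sigma> ^^ d) e * corr d" (is ?high)
proof -
  have "(\<sigma> ^^ d) (coeff (skew_mult \<sigma> g h) (k - d)) =
      (\<Sum>u=0..k - d. (\<sigma> ^^ d) (coeff g u) * (\<sigma> ^^ (u + d)) (coeff h (k - (u + d))))"
    unfolding coeff_skew_mult[OF hom] pow.hom_sum atMost_atLeast0
    by (rule sum.cong) (auto simp: pow.hom_mult add.commute[of _ d] funpow_add)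
  also have "\<dots> = e * corr d"
    unfolding corr_def sum_distrib_left
    by (rule sum.cong) (use d in \<open>auto simp: rev mult_ac\<close>)
  finally show ?low .
  have "coeff (skew_mult \<sigma> g h) (k + d) =
      (\<Sum>i\<in>{d..k}. coeff g i * (\<sigma> ^^ i) (coeff h (k + d - i)))"
    unfolding coeff_skew_mult[OF hom]
    by (rule sum.mono_neutral_right) (use deg in \<open>auto simp: not_le coeff_g_eq_0 coeff_eq_0\<close>)
  also have "\<dots> = (\<Sum>u=0..k - d. coeff g (u + d) * (\<sigma> ^^ (u + d)) (coeff h (k + d - (u + d))))"
    using d sum.shift_bounds_cl_nat_ivl[of "\<lambda>i. coeff g i * (\<sigma> ^^ i) (coeff h (k + d - i))" 0 d "k - d"]
    by simp
  also have "\<dots> = (\<Sum>u=0..k - d. coeff g (u + d) * (\<sigma> ^^ d) ((\<sigma> ^^ u) (coeff h (k - u))))"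
    by (rule sum.cong) (auto simp: add.commute[of _ d] funpow_add)
  also have "\<dots> = (\<sigma> ^^ d) e * corr d"
    unfolding corr_def sum_distrib_left
    by (rule sum.cong) (auto simp: rev pow.hom_mult mult_ac)
  finally show ?high .
qed

text \<open>
  The polynomial \<open>w = X\<^sup>k g - X\<^bsup>2k\<^esup> + a\<close> is the constacyclic shift of the last spanning word.
  It is orthogonal to \<open>X\<^sup>i g\<close>: for \<open>0 < i\<close> this is \<open>S\<^bsub>k-i\<^esub> = 0\<close>, while for \<open>i = 0\<close> the
  product is \<open>S\<^sub>k + a g\<^sub>0\<close> with \<open>S\<^sub>k = \<sigma>\<^sup>k(g\<^sub>0)\<close>, which is what the choice of \<open>a\<close> cancels.
  Self-duality then puts \<open>w\<close>, and hence \<open>X\<^bsup>2k\<^esup> - a = X\<^sup>k g - w\<close>, into \<open>(g)\<^sub>l\<close>.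
\<close>

lemma right_divides_of_corr:
  assumes corr: "\<forall>d<k. corr d = 0" and a: "(\<sigma> ^^ k) (coeff g 0) + a * coeff g 0 = 0"
  shows "right_divides \<sigma> g (monom 1 (2 * k) - [:a:])"
proof -
  define w where "w = shift k - monom 1 (2 * k) + [:a:]"
  have coeff_const: "coeff [:a:] m = (if m = 0 then a else 0)" for m by (cases m) auto
  have w_high: "coeff w m = 0" if "2 * k \<le> m" for m
    using that k_pos monic_g by (cases "m = 2 * k") (auto simp: w_def coeff_const coeff_shift coeff_g_eq_0)
  have word: "word_poly (vec (2 * k) (coeff w)) = w"
    by (rule word_poly_vec_coeff) (rule w_high)
  have "pairing (shift i) w = 0" if i: "i < k" for i
  proof -
    have "pairing (shift i) w = pairing (shift i) (shift k) + pairing (shift i) [:a:]"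
      unfolding pairing_def sum.distrib[symmetric]
      by (rule sum.cong) (auto simp: w_def algebra_simps)
    also have "pairing (shift i) (shift k) = (\<sigma> ^^ i) (corr (k - i))"
      using pairing_shift_shift[of i "k - i"] i by simp
    also have "pairing (shift i) [:a:] = (\<Sum>m<2 * k. if m = 0 then coeff (shift i) 0 * a else 0)"
      unfolding pairing_def by (rule sum.cong) (auto simp: coeff_const)
    also have "\<dots> = coeff (shift i) 0 * a" using k_pos by simp
    finally have *: "pairing (shift i) w = (\<sigma> ^^ i) (corr (k - i)) + coeff (shift i) 0 * a" .
    show ?thesis
    proof (cases "i = 0")
      case True
      then show ?thesis
        using * a by (simp add: coeff_shift corr_def monic_g mult.commute)
    next
      case False
      then show ?thesis using * corr i by (simp add: coeff_shift)
    qed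
  qed
  then have "vec (2 * k) (coeff w) \<in> dual_code (2 * k) code"
    by (simp add: in_dual_code_iff word)
  then have "w \<in> left_ideal \<sigma> g"
    using code_self_dual_iff_corr corr word by (auto simp: code_def)
  then have "shift k + - w \<in> left_ideal \<sigma> g"
    by (intro left_ideal_add[OF hom] left_ideal_uminus[OF hom] shift_in_left_ideal)
  moreover have "shift k + - w = monom 1 (2 * k) - [:a:]" by (simp add: w_def)
  ultimately show ?thesis by (auto simp: left_ideal_def right_divides_def)
qed

lemma constacyclic_codeI:
  assumes "a dvd 1" and "right_divides \<sigma> g (monom 1 (2 * k) - [:a:])"
  shows "is_constacyclic_code \<sigma> (2 * k) a g code"
proof -
  let ?f = "monom 1 (2 * k) - [:a:]"
  have coeff_const: "coeff [:a:] m = (if m = 0 then a else 0)" for m by (cases m) auto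
  have le: "degree ?f \<le> 2 * k"
    by (rule degree_le) (use k_pos in \<open>auto simp: coeff_const\<close>)
  have top: "coeff ?f (2 * k) = 1" using k_pos by (simp add: coeff_const)
  then have "2 * k \<le> degree ?f" by (intro le_degree) simp
  with le have "degree ?f = 2 * k" by simp
  then have "is_principal_f_code \<sigma> (2 * k) ?f g (principal_code \<sigma> ?f g)"
    using top assms(2) by (simp add: is_principal_f_code_def)
  moreover from principal_code_eq[OF hom this] have "principal_code \<sigma> ?f g = code"
    by (simp add: code_def)
  ultimately show ?thesis using assms(1) by (simp add: is_constacyclic_code_def)
qed

lemma funpow_inverse:
  assumes "bij \<sigma>"
  shows "(\<sigma> ^^ i) ((inv_into UNIV \<sigma> ^^ i) x) = x" and "(inv_into UNIV \<sigma> ^^ i) ((\<sigma> ^^ i) x) = x"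
  using bij_is_surj[OF assms] bij_is_inj[OF assms]
  by (induction i arbitrary: x) (auto simp: funpow_swap1 surj_f_inv_f inv_f_f)

text \<open>
  The constant term of \<open>g h\<close> is a unit, so \<open>h\<^sub>0\<close> is one and the reciprocity condition can be solved
  for the coefficients of \<open>h\<close>, giving the reversal relation with \<open>e = \<sigma>\<^sup>k(h\<^sub>0)\<close>.  The vanishing
  coefficients of \<open>X\<^bsup>2k\<^esup> - \<sigma>\<^bsup>-k\<^esup>(a)\<close> at the positions \<open>k - d\<close> then give the claim.
\<close>

lemma corr_eq_0_of_factorization:
  assumes bij: "bij \<sigma>" and a: "a dvd 1" and h: "degree h = k"
    and gh: "skew_mult \<sigma> g h = monom 1 (2 * k) - [:(inv_into UNIV \<sigma> ^^ k) a:]"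
    and rec: "skew_mult \<sigma> [:(\<sigma> ^^ k) (unit_inv (coeff h 0)):] (skew_recip \<sigma> h) = g"
  shows "\<forall>d<k. corr d = 0"
proof (intro allI impI)
  fix d assume d: "d < k"
  obtain b where b: "a * b = 1" using a by (auto simp: dvd_def)
  define c where "c = unit_inv (coeff h 0)"
  let ?a' = "(inv_into UNIV \<sigma> ^^ k) a" and ?b' = "(inv_into UNIV \<sigma> ^^ k) b"
  have "(\<sigma> ^^ k) (?a' * ?b') = (\<sigma> ^^ k) 1"
    by (simp add: pow.hom_mult funpow_inverse[OF bij] b)
  then have ab: "?a' * ?b' = 1"
    using funpow_inverse(2)[OF bij] by metis
  \<comment> \<open>\<open>unit_inv\<close> is a description operator, so \<open>h\<^sub>0\<close> needs an explicit inverse first.\<close>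
  have "coeff g 0 * coeff h 0 = - ?a'"
    using arg_cong[OF gh, of "\<lambda>p. coeff p 0"] k_pos by (simp add: coeff_skew_mult[OF hom])
  then have "coeff h 0 * (coeff g 0 * - ?b') = 1"
    using ab by (simp add: mult.assoc[symmetric] mult.commute[of "coeff h 0"])
  then have "coeff h 0 * c = 1"
    using unit_inv_eq by (metis c_def)
  then have c: "(\<sigma> ^^ k) (coeff h 0) * (\<sigma> ^^ k) c = 1"
    by (simp add: pow.hom_mult[symmetric])
  have rev: "(\<sigma> ^^ u) (coeff h (k - u)) = (\<sigma> ^^ k) (coeff h 0) * coeff g u" if "u \<le> k" for u
  proof -
    have "coeff g u = (\<sigma> ^^ k) c * (\<sigma> ^^ u) (coeff h (k - u))"
      using arg_cong[OF rec, of "\<lambda>p. coeff p u"] that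
      by (simp add: skew_mult_const_left[OF hom] skew_recip_def coeff_sum_monom h c_def)
    then show ?thesis using c by (simp add: mult.assoc[symmetric])
  qed
  have "coeff (skew_mult \<sigma> g h) (k - d) = 0"
    using d by (simp add: gh coeff_eq_0)
  then have "(\<sigma> ^^ k) (coeff h 0) * corr d = 0"
    using coeff_skew_mult_reversal(1)[OF rev, of d] h d by simp
  then have "(\<sigma> ^^ k) c * ((\<sigma> ^^ k) (coeff h 0) * corr d) = 0" by simp
  then show "corr d = 0"
    using c by (simp add: mult.assoc[symmetric] mult.commute[of "(\<sigma> ^^ k) c"])
qed

text \<open>
  The reversal relation with \<open>e = g\<^sub>0\<^bsup>-1\<^esup>\<close> is taken as the definition of \<open>h\<close>; this is the only
  possible \<open>e\<close>, as \<open>h\<close> must be monic and \<open>u = 0\<close> reads \<open>h\<^sub>k = e g\<^sub>0\<close>.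
\<close>

lemma factorization_of_corr:
  assumes bij: "bij \<sigma>" and corr: "\<forall>d<k. corr d = 0" and e: "coeff g 0 * e = 1"
  shows "\<exists>h. degree h = k \<and>
    skew_mult \<sigma> g h = monom 1 (2 * k) - [:(inv_into UNIV \<sigma> ^^ k) (- (\<sigma> ^^ k) (coeff g 0) * e):] \<and>
    skew_mult \<sigma> [:(\<sigma> ^^ k) (unit_inv (coeff h 0)):] (skew_recip \<sigma> h) = g"
proof -
  let ?\<tau> = "inv_into UNIV \<sigma>"
  let ?a = "- (\<sigma> ^^ k) (coeff g 0) * e"
  note \<sigma>\<tau> = funpow_inverse(1)[OF bij]
  have inj: "x = y" if "(\<sigma> ^^ i) x = (\<sigma> ^^ i) y" for i x y
    using funpow_inverse(2)[OF bij] that by metis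
  have e': "e * coeff g 0 = 1" using e by (simp add: mult.commute)
  have coeff_const: "coeff [:c:] m = (if m = 0 then c else 0)" for c :: 'a and m
    by (cases m) auto
  define h where "h = (\<Sum>j\<le>k. monom ((?\<tau> ^^ (k - j)) (e * coeff g (k - j))) j)"
  have coeff_h: "coeff h j = (if j \<le> k then (?\<tau> ^^ (k - j)) (e * coeff g (k - j)) else 0)" for j
    by (simp add: h_def coeff_sum_monom)
  have "coeff h k = 1" by (simp add: coeff_h e')
  then have degree_h: "degree h = k"
    by (intro antisym degree_le le_degree) (auto simp: coeff_h)
  have rev: "(\<sigma> ^^ u) (coeff h (k - u)) = e * coeff g u" if "u \<le> k" for u
    using that by (simp add: coeff_h \<sigma>\<tau>)
  note low = coeff_skew_mult_reversal(1)[OF rev] and high = coeff_skew_mult_reversal(2)[OF rev]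
  have corr_k: "corr k = (\<sigma> ^^ k) (coeff g 0)" by (simp add: corr_def monic_g)
  have "skew_mult \<sigma> g h = monom 1 (2 * k) - [:(?\<tau> ^^ k) ?a:]"
  proof (rule poly_eqI)
    fix m
    consider "m = 0" | "0 < m" "m \<le> k" | "k < m" "m < 2 * k" | "m = 2 * k" | "2 * k < m"
      by linarith
    then show "coeff (skew_mult \<sigma> g h) m = coeff (monom 1 (2 * k) - [:(?\<tau> ^^ k) ?a:]) m"
    proof cases
      case 1
      have "(\<sigma> ^^ k) (coeff (skew_mult \<sigma> g h) 0) = - ?a"
        using low[of k] degree_h by (simp add: corr_k mult.commute)
      also have "\<dots> = (\<sigma> ^^ k) (- (?\<tau> ^^ k) ?a)" by (simp add: pow.hom_uminus \<sigma>\<tau>)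
      finally have "coeff (skew_mult \<sigma> g h) 0 = - (?\<tau> ^^ k) ?a" by (rule inj)
      then show ?thesis using 1 k_pos by simp
    next
      case 2
      then have "(\<sigma> ^^ (k - m)) (coeff (skew_mult \<sigma> g h) m) = (\<sigma> ^^ (k - m)) 0"
        using low[of "k - m"] degree_h corr by simp
      then have "coeff (skew_mult \<sigma> g h) m = 0" by (rule inj)
      then show ?thesis using 2 by (simp add: coeff_const)
    next
      case 3
      then show ?thesis
        using high[of "m - k"] degree_h corr by (simp add: coeff_const)
    next
      case 4
      have "coeff (skew_mult \<sigma> g h) (2 * k) = (\<sigma> ^^ k) (e * coeff g 0)"
        using high[of k] degree_h by (simp add: corr_k pow.hom_mult mult_2)
      then show ?thesis using 4 e' k_pos by (simp add: coeff_const)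
    next
      case 5
      have "coeff g i * (\<sigma> ^^ i) (coeff h (m - i)) = 0" for i
        using 5 coeff_g_eq_0[of i] by (cases "k < i") (auto simp: coeff_h)
      then show ?thesis using 5 by (simp add: coeff_skew_mult[OF hom] coeff_const)
    qed
  qed
  moreover have "skew_mult \<sigma> [:(\<sigma> ^^ k) (unit_inv (coeff h 0)):] (skew_recip \<sigma> h) = g"
  proof (rule poly_eqI)
    fix m
    have "(\<sigma> ^^ k) (coeff h 0 * (?\<tau> ^^ k) (coeff g 0)) = (\<sigma> ^^ k) 1"
      by (simp add: coeff_h pow.hom_mult \<sigma>\<tau> monic_g e')
    then have "coeff h 0 * (?\<tau> ^^ k) (coeff g 0) = 1" by (rule inj)
    then have "(\<sigma> ^^ k) (unit_inv (coeff h 0)) = coeff g 0"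
      by (simp add: unit_inv_eq \<sigma>\<tau>)
    then show "coeff (skew_mult \<sigma> [:(\<sigma> ^^ k) (unit_inv (coeff h 0)):] (skew_recip \<sigma> h)) m = coeff g m"
      by (simp add: skew_mult_const_left[OF hom] skew_recip_def coeff_sum_monom degree_h
          rev coeff_g_eq_0 e mult.assoc[symmetric])
  qed
  ultimately show ?thesis using degree_h by blast
qed

end

theorem corollary4p7:
  fixes \<sigma> :: "'a::{comm_ring_1,finite} \<Rightarrow> 'a"
    and n k :: nat
    and g :: "'a poly"
    and C :: "'a vec set"
  assumes "comm_ring_hom \<sigma>" and "bij \<sigma>"
    and "0 < k" and "n = 2 * k"
    and "degree g = k" and "lead_coeff g = 1" and "coeff g 0 dvd 1"
    and "is_principal_code \<sigma> n g C"
  shows "(C = dual_code n C \<longleftrightarrow>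
           (\<exists>a. is_constacyclic_code \<sigma> n a g C \<and>
             (\<exists>h. degree h = k \<and>
                  skew_mult \<sigma> g h = monom 1 n - [:(inv_into UNIV \<sigma> ^^ k) a:] \<and>
                  skew_mult \<sigma> [:(\<sigma> ^^ k) (unit_inv (coeff h 0)):] (skew_recip \<sigma> h) = g)))
       \<and> (C = dual_code n C \<longleftrightarrow>
           (\<forall>l\<in>{1..k}. (\<Sum>i=0..l. (\<sigma> ^^ (k - l)) (coeff g i) * coeff g (i + (k - l))) = 0))"
proof -
  interpret skew_generator \<sigma> k g
    using assms by (auto simp: skew_generator_def skew_generator_axioms_def)
  have C: "C = code"
    using assms(8) principal_code_eq[OF hom] assms(4)
    by (auto simp: is_principal_code_def code_def)
  have n: "n = 2 * k" by fact

  have iii: "(\<forall>l\<in>{1..k}. (\<Sum>i=0..l. (\<sigma> ^^ (k - l)) (coeff g i) * coeff g (i + (k - l))) = 0)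
      \<longleftrightarrow> (\<forall>d<k. corr d = 0)" (is "?iii \<longleftrightarrow> _")
  proof
    assume *: ?iii
    show "\<forall>d<k. corr d = 0"
    proof (intro allI impI)
      fix d assume "d < k"
      then show "corr d = 0" using bspec[OF *, of "k - d"] by (simp add: corr_def)
    qed
  next
    assume *: "\<forall>d<k. corr d = 0"
    show ?iii
    proof
      fix l assume "l \<in> {1..k}"
      then show "(\<Sum>i=0..l. (\<sigma> ^^ (k - l)) (coeff g i) * coeff g (i + (k - l))) = 0"
        using *[rule_format, of "k - l"] by (simp add: corr_def)
    qed
  qed

  have ii: "(\<exists>a. is_constacyclic_code \<sigma> n a g C \<and>
             (\<exists>h. degree h = k \<and>
                  skew_mult \<sigma> g h = monom 1 n - [:(inv_into UNIV \<sigma> ^^ k) a:] \<and>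
                  skew_mult \<sigma> [:(\<sigma> ^^ k) (unit_inv (coeff h 0)):] (skew_recip \<sigma> h) = g))
      \<longleftrightarrow> (\<forall>d<k. corr d = 0)" (is "?ii \<longleftrightarrow> _")
  proof
    assume ?ii
    then obtain a h where "a dvd 1" and h: "degree h = k"
      "skew_mult \<sigma> g h = monom 1 (2 * k) - [:(inv_into UNIV \<sigma> ^^ k) a:]"
      "skew_mult \<sigma> [:(\<sigma> ^^ k) (unit_inv (coeff h 0)):] (skew_recip \<sigma> h) = g"
      by (auto simp: is_constacyclic_code_def n)
    then show "\<forall>d<k. corr d = 0"
      using corr_eq_0_of_factorization[OF assms(2) _ h] by blast
  next
    assume corr: "\<forall>d<k. corr d = 0"
    obtain e where e: "coeff g 0 * e = 1" using unit_g0 by (auto simp: dvd_def)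
    define a where "a = - (\<sigma> ^^ k) (coeff g 0) * e"
    have a: "(\<sigma> ^^ k) (coeff g 0) + a * coeff g 0 = 0"
      using e by (simp add: a_def mult.assoc mult.commute[of e])
    have "a * (- (\<sigma> ^^ k) e * coeff g 0) = (\<sigma> ^^ k) (coeff g 0 * e) * (coeff g 0 * e)"
      by (simp add: a_def pow.hom_mult mult_ac)
    then have "a dvd 1" by (metis dvdI e mult_1 pow.hom_one)
    then have "is_constacyclic_code \<sigma> n a g C"
      unfolding n C by (rule constacyclic_codeI) (rule right_divides_of_corr[OF corr a])
    moreover obtain h where "degree h = k"
      "skew_mult \<sigma> g h = monom 1 (2 * k) - [:(inv_into UNIV \<sigma> ^^ k) a:]"
      "skew_mult \<sigma> [:(\<sigma> ^^ k) (unit_inv (coeff h 0)):] (skew_recip \<sigma> h) = g"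
      using factorization_of_corr[OF assms(2) corr e] unfolding a_def by blast
    ultimately show ?ii unfolding n by blast
  qed
  show ?thesis
    unfolding ii iii using code_self_dual_iff_corr by (simp add: C n)
qed

end
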